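(* Any Hamiltonian prelinear $\mathrm{e}$-cyclic residuated lattice is semilinear.
   Context: A residuated lattice is an algebra $\mathbf{L}=\langle L,\wedge,\vee,\cdot,\backslash,/,\mathrm{e}\rangle$ such that $\langle L,\cdot,\mathrm{e}\rangle$ is a monoid, $\langle L,\wedge,\vee\rangle$ is a lattice, and for all $a,b,d\in L$: $ab\le d \iff a\le d/b \iff b\le a\backslash d$. It is $\mathrm{e}$-cyclic if it satisfies $x\backslash \mathrm{e}\approx \mathrm{e}/x$. It is prelinear if it satisfies both $(x\backslash y\wedge \mathrm{e})\vee(y\backslash x\wedge \mathrm{e})\approx \mathrm{e}$ and $(x/y\wedge \mathrm{e})\vee(y/x\wedge \mathrm{e})\approx \mathrm{e}$ (residuals bind more strongly than $\wedge,\vee$). For $a,b\in L$ put $\lambda_b(a)=(b\backslash ab)\wedge \mathrm{e}$ and $\rho_b(a)=(ba/b)\wedge \mathrm{e}$. A convex subuniverse of $\mathbf{L}$ is a subuniverse (subset closed under all operations) that is order-convex; a convex subuniverse $H$ is normal if $\lambda_b(a)\in H$ and $\rho_b(a)\in H$ for all $a\in H$, $b\in L$. $\mathbf{L}$ is Hamiltonian if every convex subuniverse of $\mathbf{L}$ is normal. $\mathbf{L}$ is semilinear if it is (isomorphic to) a subdirect product of totally ordered residuated lattices. *)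

theory Defs
  imports "HOL-Algebra.Group"
begin

record 'a resid_lattice = "'a monoid" +
  rl_meet :: "['a, 'a] \<Rightarrow> 'a" (infixl \<open>\<^bold>\<and>\<index>\<close> 60)
  rl_join :: "['a, 'a] \<Rightarrow> 'a" (infixl \<open>\<^bold>\<or>\<index>\<close> 60)
  ldiv :: "['a, 'a] \<Rightarrow> 'a" (infixl \<open>\<setminus>\<index>\<close> 65)
  rdiv :: "['a, 'a] \<Rightarrow> 'a" (infixl \<open>\<sslash>\<index>\<close> 65)

definition rl_le :: "[('a, 'm) resid_lattice_scheme, 'a, 'a] \<Rightarrow> bool" (infix \<open>\<preceq>\<index>\<close> 50)
  where "x \<preceq>\<^bsub>L\<^esub> y \<longleftrightarrow> x \<^bold>\<and>\<^bsub>L\<^esub> y = x"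

locale residuated_lattice = monoid L for L (structure) +
  assumes meet_closed [intro, simp]: "\<lbrakk>x \<in> carrier L; y \<in> carrier L\<rbrakk> \<Longrightarrow> x \<^bold>\<and> y \<in> carrier L"
    and join_closed [intro, simp]: "\<lbrakk>x \<in> carrier L; y \<in> carrier L\<rbrakk> \<Longrightarrow> x \<^bold>\<or> y \<in> carrier L"
    and ldiv_closed [intro, simp]: "\<lbrakk>x \<in> carrier L; y \<in> carrier L\<rbrakk> \<Longrightarrow> x \<setminus> y \<in> carrier L"
    and rdiv_closed [intro, simp]: "\<lbrakk>x \<in> carrier L; y \<in> carrier L\<rbrakk> \<Longrightarrow> x \<sslash> y \<in> carrier L"
    and meet_assoc: "\<lbrakk>x \<in> carrier L; y \<in> carrier L; z \<in> carrier L\<rbrakk>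
      \<Longrightarrow> (x \<^bold>\<and> y) \<^bold>\<and> z = x \<^bold>\<and> (y \<^bold>\<and> z)"
    and meet_comm: "\<lbrakk>x \<in> carrier L; y \<in> carrier L\<rbrakk> \<Longrightarrow> x \<^bold>\<and> y = y \<^bold>\<and> x"
    and join_assoc: "\<lbrakk>x \<in> carrier L; y \<in> carrier L; z \<in> carrier L\<rbrakk>
      \<Longrightarrow> (x \<^bold>\<or> y) \<^bold>\<or> z = x \<^bold>\<or> (y \<^bold>\<or> z)"
    and join_comm: "\<lbrakk>x \<in> carrier L; y \<in> carrier L\<rbrakk> \<Longrightarrow> x \<^bold>\<or> y = y \<^bold>\<or> x"
    and meet_join_absorb: "\<lbrakk>x \<in> carrier L; y \<in> carrier L\<rbrakk> \<Longrightarrow> x \<^bold>\<and> (x \<^bold>\<or> y) = x"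
    and join_meet_absorb: "\<lbrakk>x \<in> carrier L; y \<in> carrier L\<rbrakk> \<Longrightarrow> x \<^bold>\<or> (x \<^bold>\<and> y) = x"
    and rdiv_residual: "\<lbrakk>a \<in> carrier L; b \<in> carrier L; d \<in> carrier L\<rbrakk>
      \<Longrightarrow> a \<otimes> b \<preceq> d \<longleftrightarrow> a \<preceq> d \<sslash> b"
    and ldiv_residual: "\<lbrakk>a \<in> carrier L; b \<in> carrier L; d \<in> carrier L\<rbrakk>
      \<Longrightarrow> a \<otimes> b \<preceq> d \<longleftrightarrow> b \<preceq> a \<setminus> d"

locale residuated_chain = residuated_lattice +
  assumes total: "\<lbrakk>x \<in> carrier L; y \<in> carrier L\<rbrakk> \<Longrightarrow> x \<preceq> y \<or> y \<preceq> x"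

definition e_cyclic :: "('a, 'm) resid_lattice_scheme \<Rightarrow> bool"
  where "e_cyclic L \<longleftrightarrow> (\<forall>x\<in>carrier L. x \<setminus>\<^bsub>L\<^esub> \<one>\<^bsub>L\<^esub> = \<one>\<^bsub>L\<^esub> \<sslash>\<^bsub>L\<^esub> x)"

definition prelinear :: "('a, 'm) resid_lattice_scheme \<Rightarrow> bool"
  where "prelinear L \<longleftrightarrow> (\<forall>x\<in>carrier L. \<forall>y\<in>carrier L.
    (x \<setminus>\<^bsub>L\<^esub> y \<^bold>\<and>\<^bsub>L\<^esub> \<one>\<^bsub>L\<^esub>) \<^bold>\<or>\<^bsub>L\<^esub> (y \<setminus>\<^bsub>L\<^esub> x \<^bold>\<and>\<^bsub>L\<^esub> \<one>\<^bsub>L\<^esub>) = \<one>\<^bsub>L\<^esub> \<and>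
    (x \<sslash>\<^bsub>L\<^esub> y \<^bold>\<and>\<^bsub>L\<^esub> \<one>\<^bsub>L\<^esub>) \<^bold>\<or>\<^bsub>L\<^esub> (y \<sslash>\<^bsub>L\<^esub> x \<^bold>\<and>\<^bsub>L\<^esub> \<one>\<^bsub>L\<^esub>) = \<one>\<^bsub>L\<^esub>)"

definition left_conj :: "[('a, 'm) resid_lattice_scheme, 'a, 'a] \<Rightarrow> 'a"
  where "left_conj L b a = (b \<setminus>\<^bsub>L\<^esub> (a \<otimes>\<^bsub>L\<^esub> b)) \<^bold>\<and>\<^bsub>L\<^esub> \<one>\<^bsub>L\<^esub>"

definition right_conj :: "[('a, 'm) resid_lattice_scheme, 'a, 'a] \<Rightarrow> 'a"
  where "right_conj L b a = ((b \<otimes>\<^bsub>L\<^esub> a) \<sslash>\<^bsub>L\<^esub> b) \<^bold>\<and>\<^bsub>L\<^esub> \<one>\<^bsub>L\<^esub>"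

definition subuniverse :: "[('a, 'm) resid_lattice_scheme, 'a set] \<Rightarrow> bool"
  where "subuniverse L H \<longleftrightarrow> H \<subseteq> carrier L \<and> \<one>\<^bsub>L\<^esub> \<in> H \<and>
    (\<forall>x\<in>H. \<forall>y\<in>H. x \<otimes>\<^bsub>L\<^esub> y \<in> H \<and> x \<^bold>\<and>\<^bsub>L\<^esub> y \<in> H \<and> x \<^bold>\<or>\<^bsub>L\<^esub> y \<in> H \<and>
      x \<setminus>\<^bsub>L\<^esub> y \<in> H \<and> x \<sslash>\<^bsub>L\<^esub> y \<in> H)"

definition convex_subuniverse :: "[('a, 'm) resid_lattice_scheme, 'a set] \<Rightarrow> bool"
  where "convex_subuniverse L H \<longleftrightarrow> subuniverse L H \<and>
    (\<forall>x\<in>H. \<forall>z\<in>H. \<forall>y\<in>carrier L. x \<preceq>\<^bsub>L\<^esub> y \<and> y \<preceq>\<^bsub>L\<^esub> z \<longrightarrow> y \<in> H)"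

definition normal_convex_subuniverse :: "[('a, 'm) resid_lattice_scheme, 'a set] \<Rightarrow> bool"
  where "normal_convex_subuniverse L H \<longleftrightarrow> convex_subuniverse L H \<and>
    (\<forall>a\<in>H. \<forall>b\<in>carrier L. left_conj L b a \<in> H \<and> right_conj L b a \<in> H)"

definition hamiltonian :: "('a, 'm) resid_lattice_scheme \<Rightarrow> bool"
  where "hamiltonian L \<longleftrightarrow>
    (\<forall>H. convex_subuniverse L H \<longrightarrow> normal_convex_subuniverse L H)"

definition rl_hom ::
    "[('a, 'm) resid_lattice_scheme, ('b, 'n) resid_lattice_scheme] \<Rightarrow> ('a \<Rightarrow> 'b) set"
  where "rl_hom L M = {h \<in> carrier L \<rightarrow> carrier M. h \<one>\<^bsub>L\<^esub> = \<one>\<^bsub>M\<^esub> \<and>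
    (\<forall>x\<in>carrier L. \<forall>y\<in>carrier L.
      h (x \<otimes>\<^bsub>L\<^esub> y) = h x \<otimes>\<^bsub>M\<^esub> h y \<and>
      h (x \<^bold>\<and>\<^bsub>L\<^esub> y) = h x \<^bold>\<and>\<^bsub>M\<^esub> h y \<and>
      h (x \<^bold>\<or>\<^bsub>L\<^esub> y) = h x \<^bold>\<or>\<^bsub>M\<^esub> h y \<and>
      h (x \<setminus>\<^bsub>L\<^esub> y) = h x \<setminus>\<^bsub>M\<^esub> h y \<and>
      h (x \<sslash>\<^bsub>L\<^esub> y) = h x \<sslash>\<^bsub>M\<^esub> h y)}"

definition rl_iso ::
    "[('a, 'm) resid_lattice_scheme, ('b, 'n) resid_lattice_scheme] \<Rightarrow> ('a \<Rightarrow> 'b) set"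
  where "rl_iso L M = {h \<in> rl_hom L M. bij_betw h (carrier L) (carrier M)}"

definition direct_product ::
    "['i set, 'i \<Rightarrow> ('b, 'n) resid_lattice_scheme] \<Rightarrow> ('i \<Rightarrow> 'b) resid_lattice"
  where "direct_product I A =
    \<lparr>carrier = (\<Pi>\<^sub>E i\<in>I. carrier (A i)),
     mult = (\<lambda>x y. \<lambda>i\<in>I. x i \<otimes>\<^bsub>A i\<^esub> y i),
     one = (\<lambda>i\<in>I. \<one>\<^bsub>A i\<^esub>),
     rl_meet = (\<lambda>x y. \<lambda>i\<in>I. x i \<^bold>\<and>\<^bsub>A i\<^esub> y i),
     rl_join = (\<lambda>x y. \<lambda>i\<in>I. x i \<^bold>\<or>\<^bsub>A i\<^esub> y i),
     ldiv = (\<lambda>x y. \<lambda>i\<in>I. x i \<setminus>\<^bsub>A i\<^esub> y i),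
     rdiv = (\<lambda>x y. \<lambda>i\<in>I. x i \<sslash>\<^bsub>A i\<^esub> y i)\<rparr>"

definition subdirect_subuniverse ::
    "['i set, 'i \<Rightarrow> ('b, 'n) resid_lattice_scheme, ('i \<Rightarrow> 'b) set] \<Rightarrow> bool"
  where "subdirect_subuniverse I A S \<longleftrightarrow> subuniverse (direct_product I A) S \<and>
    (\<forall>i\<in>I. (\<lambda>x. x i) ` S = carrier (A i))"

definition subdirect_rep_by_chains ::
    "[('a, 'm) resid_lattice_scheme, 'i set, 'i \<Rightarrow> ('b, 'n) resid_lattice_scheme] \<Rightarrow> bool"
  where "subdirect_rep_by_chains L I A \<longleftrightarrow> (\<forall>i\<in>I. residuated_chain (A i)) \<and>
    (\<exists>S. subdirect_subuniverse I A S \<and>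
      rl_iso L (direct_product I A \<lparr>carrier := S\<rparr>) \<noteq> {})"

text \<open>HOL cannot quantify over the types of the indices and of the elements of the factors.
  Each factor is a homomorphic image of \<open>L\<close>, so it can be taken to live on a set of subsets of
  \<open>carrier L\<close> (the classes of the kernel) and to be indexed by that kernel. Fixing the two types
  accordingly loses nothing: see \<open>semilinearI\<close> below.\<close>

definition semilinear :: "('a, 'm) resid_lattice_scheme \<Rightarrow> bool"
  where "semilinear L \<longleftrightarrow> (\<exists>(I :: ('a \<times> 'a) set set) (A :: ('a \<times> 'a) set \<Rightarrow> 'a set resid_lattice).
    subdirect_rep_by_chains L I A)"

lemma subdirect_rep_by_chainsD:
  assumes "subdirect_rep_by_chains L I A"
  obtains f where "\<forall>i\<in>I. residuated_chain (A i)"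
    and "\<forall>i\<in>I. (\<lambda>x. f x i) \<in> rl_hom L (A i)"
    and "\<forall>i\<in>I. (\<lambda>x. f x i) ` carrier L = carrier (A i)"
    and "\<forall>x\<in>carrier L. \<forall>y\<in>carrier L. (\<forall>i\<in>I. f x i = f y i) \<longrightarrow> x = y"
proof -
  from assms obtain S f where ch: "\<forall>i\<in>I. residuated_chain (A i)"
    and S: "subdirect_subuniverse I A S"
    and f: "f \<in> rl_iso L (direct_product I A \<lparr>carrier := S\<rparr>)"
    unfolding subdirect_rep_by_chains_def by blast
  have bij: "bij_betw f (carrier L) S"
    and hom: "f \<in> rl_hom L (direct_product I A \<lparr>carrier := S\<rparr>)"
    using f by (auto simp: rl_iso_def)
  have SP: "S \<subseteq> (\<Pi>\<^sub>E i\<in>I. carrier (A i))" and proj: "\<forall>i\<in>I. (\<lambda>x. x i) ` S = carrier (A i)"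
    using S by (auto simp: subdirect_subuniverse_def subuniverse_def direct_product_def)
  have fS: "f ` carrier L = S" and inj: "inj_on f (carrier L)"
    using bij by (auto simp: bij_betw_def)
  have im: "(\<lambda>x. f x i) ` carrier L = carrier (A i)" if "i \<in> I" for i
    using proj that by (simp add: image_image flip: fS)
  have homi: "(\<lambda>x. f x i) \<in> rl_hom L (A i)" if "i \<in> I" for i
    using hom that im[OF that] by (auto simp: rl_hom_def direct_product_def)
  have sep: "x = y" if xy: "x \<in> carrier L" "y \<in> carrier L" and eq: "\<forall>i\<in>I. f x i = f y i" for x y
  proof -
    have "f x \<in> (\<Pi>\<^sub>E i\<in>I. carrier (A i))" "f y \<in> (\<Pi>\<^sub>E i\<in>I. carrier (A i))"
      using SP fS xy by auto
    then have "f x = f y" using eq by (auto intro: PiE_ext)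
    then show "x = y" using inj xy by (auto dest: inj_onD)
  qed
  show ?thesis
    by (rule that[of f, OF ch]) (use im homi sep in blast)+
qed

lemma subdirect_rep_by_chainsI:
  assumes L: "residuated_lattice L"
    and ch: "\<forall>i\<in>I. residuated_chain (A i)"
    and hom: "\<And>i. i \<in> I \<Longrightarrow> g i \<in> rl_hom L (A i)"
    and surj: "\<And>i. i \<in> I \<Longrightarrow> g i ` carrier L = carrier (A i)"
    and sep: "\<And>x y. \<lbrakk>x \<in> carrier L; y \<in> carrier L; \<forall>i\<in>I. g i x = g i y\<rbrakk> \<Longrightarrow> x = y"
  shows "subdirect_rep_by_chains L I A"
proof -
  interpret residuated_lattice L by (rule L)
  define f where "f = (\<lambda>x. \<lambda>i\<in>I. g i x)"
  define S where "S = f ` carrier L"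
  have fhom: "f \<in> rl_hom L (direct_product I A \<lparr>carrier := S\<rparr>)"
    using hom by (auto simp: rl_hom_def direct_product_def f_def S_def fun_eq_iff restrict_def)
  have inj: "inj_on f (carrier L)"
    by (rule inj_onI) (rule sep, auto simp: f_def fun_eq_iff restrict_def split: if_splits)
  have iso: "f \<in> rl_iso L (direct_product I A \<lparr>carrier := S\<rparr>)"
    using fhom inj by (simp add: rl_iso_def bij_betw_def S_def)
  have op: "f x \<otimes>\<^bsub>direct_product I A\<^esub> f y = f (x \<otimes>\<^bsub>L\<^esub> y)"
      "f x \<^bold>\<and>\<^bsub>direct_product I A\<^esub> f y = f (x \<^bold>\<and>\<^bsub>L\<^esub> y)"
      "f x \<^bold>\<or>\<^bsub>direct_product I A\<^esub> f y = f (x \<^bold>\<or>\<^bsub>L\<^esub> y)"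
      "f x \<setminus>\<^bsub>direct_product I A\<^esub> f y = f (x \<setminus>\<^bsub>L\<^esub> y)"
      "f x \<sslash>\<^bsub>direct_product I A\<^esub> f y = f (x \<sslash>\<^bsub>L\<^esub> y)"
    if "x \<in> carrier L" "y \<in> carrier L" for x y
    using fhom that by (auto simp: rl_hom_def)
  have "\<one>\<^bsub>direct_product I A\<^esub> = f \<one>\<^bsub>L\<^esub>" using fhom by (auto simp: rl_hom_def)
  moreover have "S \<subseteq> carrier (direct_product I A)"
    using hom by (auto simp: S_def f_def direct_product_def rl_hom_def Pi_iff)
  ultimately have "subuniverse (direct_product I A) S"
    unfolding subuniverse_def S_def by (auto simp: op)
  moreover have "\<forall>i\<in>I. (\<lambda>x. x i) ` S = carrier (A i)"
    using surj by (auto simp: S_def f_def image_image)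
  ultimately show ?thesis
    using ch iso unfolding subdirect_rep_by_chains_def subdirect_subuniverse_def by blast
qed

lemma residuated_chain_transfer:
  assumes M: "residuated_chain M"
    and hom: "h \<in> rl_hom M N" and bij: "bij_betw h (carrier M) (carrier N)"
  shows "residuated_chain N"
proof -
  interpret M: residuated_chain M by (rule M)
  have C: "carrier N = h ` carrier M" and inj: "inj_on h (carrier M)"
    using bij by (auto simp: bij_betw_def)
  have one: "\<one>\<^bsub>N\<^esub> = h \<one>\<^bsub>M\<^esub>" using hom by (auto simp: rl_hom_def)
  have op: "h x \<otimes>\<^bsub>N\<^esub> h y = h (x \<otimes>\<^bsub>M\<^esub> y)"
      "h x \<^bold>\<and>\<^bsub>N\<^esub> h y = h (x \<^bold>\<and>\<^bsub>M\<^esub> y)"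
      "h x \<^bold>\<or>\<^bsub>N\<^esub> h y = h (x \<^bold>\<or>\<^bsub>M\<^esub> y)"
      "h x \<setminus>\<^bsub>N\<^esub> h y = h (x \<setminus>\<^bsub>M\<^esub> y)"
      "h x \<sslash>\<^bsub>N\<^esub> h y = h (x \<sslash>\<^bsub>M\<^esub> y)"
    if "x \<in> carrier M" "y \<in> carrier M" for x y
    using hom that by (auto simp: rl_hom_def)
  have le: "h x \<preceq>\<^bsub>N\<^esub> h y \<longleftrightarrow> x \<preceq>\<^bsub>M\<^esub> y"
    if "x \<in> carrier M" "y \<in> carrier M" for x y
    using that inj by (auto simp: rl_le_def op inj_on_eq_iff)
  show ?thesis
  proof
    fix x y assume "x \<in> carrier N" "y \<in> carrier N"
    then show "x \<preceq>\<^bsub>N\<^esub> y \<or> y \<preceq>\<^bsub>N\<^esub> x" 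
      using M.total le unfolding C by (elim imageE) blast
  qed (auto simp: C one op le M.m_assoc M.meet_assoc M.join_assoc M.meet_join_absorb
      M.join_meet_absorb M.rdiv_residual[symmetric] M.ldiv_residual[symmetric]
      intro: arg_cong[OF M.meet_comm] arg_cong[OF M.join_comm])
qed

lemma semilinearI:
  fixes L :: "('a, 'm) resid_lattice_scheme"
    and I :: "'i set" and A :: "'i \<Rightarrow> ('b, 'n) resid_lattice_scheme"
  assumes L: "residuated_lattice L" and rep: "subdirect_rep_by_chains L I A"
  shows "semilinear L"
proof -
  obtain f where ch: "\<forall>i\<in>I. residuated_chain (A i)"
    and hom0: "\<forall>i\<in>I. (\<lambda>x. f x i) \<in> rl_hom L (A i)"
    and surj0: "\<forall>i\<in>I. (\<lambda>x. f x i) ` carrier L = carrier (A i)"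
    and sep0: "\<forall>x\<in>carrier L. \<forall>y\<in>carrier L. (\<forall>i\<in>I. f x i = f y i) \<longrightarrow> x = y"
    by (rule subdirect_rep_by_chainsD[OF rep])
  note hom = hom0[rule_format] and surj = surj0[rule_format]
  have sep: "x = y" if "x \<in> carrier L" "y \<in> carrier L" "\<forall>i\<in>I. f x i = f y i" for x y
    using sep0 that by blast
  define K where "K i = {(x, y). x \<in> carrier L \<and> y \<in> carrier L \<and> f x i = f y i}" for i
  define J where "J = K ` I"
  define r where "r k = inv_into I K k" for k
  have r: "r k \<in> I" "K (r k) = k" if "k \<in> J" for k
    using inv_into_into[of k K I] f_inv_into_f[of k K I] that unfolding J_def r_def by simp_all
  define c where "c k b = {x \<in> carrier L. f x (r k) = b}" for k b
  define d where "d k = inv_into (carrier (A (r k))) (c k)" for k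
  define B where "B k =
    \<lparr>carrier = c k ` carrier (A (r k)),
     mult = (\<lambda>x y. c k (d k x \<otimes>\<^bsub>A (r k)\<^esub> d k y)),
     one = c k \<one>\<^bsub>A (r k)\<^esub>,
     rl_meet = (\<lambda>x y. c k (d k x \<^bold>\<and>\<^bsub>A (r k)\<^esub> d k y)),
     rl_join = (\<lambda>x y. c k (d k x \<^bold>\<or>\<^bsub>A (r k)\<^esub> d k y)),
     ldiv = (\<lambda>x y. c k (d k x \<setminus>\<^bsub>A (r k)\<^esub> d k y)),
     rdiv = (\<lambda>x y. c k (d k x \<sslash>\<^bsub>A (r k)\<^esub> d k y))\<rparr>" for k
  have inj: "inj_on (c k) (carrier (A (r k)))" if k: "k \<in> J" for k
  proof (rule inj_onI)
    fix a b assume "a \<in> carrier (A (r k))" and eq: "c k a = c k b"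
    then obtain x where "x \<in> carrier L" "f x (r k) = a"
      using surj[OF r(1)[OF k]] by (metis imageE)
    then have "x \<in> c k a" by (simp add: c_def)
    with eq show "a = b" by (auto simp: c_def)
  qed
  have cd: "d k (c k a) = a" if "k \<in> J" "a \<in> carrier (A (r k))" for k a
    using inj that by (simp add: d_def)
  have chom: "c k \<in> rl_hom (A (r k)) (B k)" if "k \<in> J" for k
    using that by (auto simp: rl_hom_def B_def cd)
  have "subdirect_rep_by_chains L J B"
  proof (rule subdirect_rep_by_chainsI[OF L, where g = "\<lambda>k x. c k (f x (r k))"])
    show "\<forall>k\<in>J. residuated_chain (B k)"
    proof
      fix k assume k: "k \<in> J"
      show "residuated_chain (B k)"
      proof (rule residuated_chain_transfer[OF _ chom[OF k]])
        show "residuated_chain (A (r k))" using ch r[OF k] by blast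
        show "bij_betw (c k) (carrier (A (r k))) (carrier (B k))"
          using inj[OF k] by (simp add: bij_betw_def B_def)
      qed
    qed
  next
    fix k assume k: "k \<in> J"
    show "(\<lambda>x. c k (f x (r k))) \<in> rl_hom L (B k)"
      using hom[OF r(1)[OF k]] chom[OF k] by (auto simp: rl_hom_def Pi_iff)
    show "(\<lambda>x. c k (f x (r k))) ` carrier L = carrier (B k)"
      by (simp add: B_def image_image flip: surj[OF r(1)[OF k]])
  next
    fix x y assume xy: "x \<in> carrier L" "y \<in> carrier L"
      and eq: "\<forall>k\<in>J. c k (f x (r k)) = c k (f y (r k))"
    show "x = y"
    proof (rule sep[OF xy], rule ballI)
      fix i assume "i \<in> I"
      then have k: "K i \<in> J" by (simp add: J_def)
      have "f x (r (K i)) = f y (r (K i))"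
        using surj[OF r(1)[OF k]] xy eq k by (intro inj_onD[OF inj[OF k]]) auto
      then have "(x, y) \<in> K (r (K i))" using xy by (simp add: K_def)
      then have "(x, y) \<in> K i" using r(2)[OF k] by simp
      then show "f x i = f y i" by (simp add: K_def)
    qed
  qed
  then show ?thesis unfolding semilinear_def by blast
qed

end

theory Submission
  imports Defs
begin

text \<open>
  To separate \<open>x\<close> from \<open>y\<close> when \<open>x \<preceq> y\<close> fails, put \<open>c = x \<setminus> y \<^bold>\<and> \<one>\<close>, which lies strictly below
  \<open>\<one>\<close>, and let \<open>H\<close> be a convex subuniverse maximal among those that omit \<open>c\<close>. Two facts make the
  quotient by \<open>H\<close> a chain in which \<open>x\<close> is still not below \<open>y\<close>.

  The first is that \<open>H\<close> is prime: if \<open>u \<^bold>\<or> v = \<one>\<close> then \<open>u \<in> H\<close> or \<open>v \<in> H\<close>. For \<open>w \<preceq> \<one>\<close> the negative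
  elements \<open>p\<close> with \<open>p \<^bold>\<or> w \<in> H\<close> form a submonoid, because
  \<open>(p \<^bold>\<or> w)(q \<^bold>\<or> w) \<preceq> pq \<^bold>\<or> w\<close>, and by \<open>e\<close>-cyclicity
  (lemma \<open>convex_subuniverse_hull\<close>) they are exactly the negative elements of a
  convex subuniverse \<open>polar H w\<close>, which contains \<open>H\<close>. If neither \<open>u\<close> nor \<open>v\<close> were in \<open>H\<close>, then
  \<open>polar H v\<close> would contain \<open>u\<close>, hence properly extend \<open>H\<close>, hence contain \<open>c\<close>. So \<open>c \<^bold>\<or> v \<in> H\<close>; now
  \<open>polar H c\<close> contains \<open>v\<close>, hence also \<open>c\<close>, so \<open>c = c \<^bold>\<or> c \<in> H\<close>, a contradiction.

  The second is that, \<open>L\<close> being Hamiltonian, \<open>H\<close> is normal. Because of normality the relation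
  ``\<open>ah \<preceq> b\<close> for some negative \<open>h \<in> H\<close>'' may equally be tested with \<open>ha \<preceq> b\<close>. This preorder is
  then compatible with multiplication on both sides, both residuation laws hold for it,
  and meets and joins of \<open>L\<close> remain greatest lower and least upper bounds. Its
  quotient is therefore a residuated lattice, and prelinearity together with primeness makes the
  order total.
\<close>

section \<open>Order and multiplication in residuated lattices\<close>

context residuated_lattice
begin

lemma meet_idem: "x \<in> carrier L \<Longrightarrow> x \<^bold>\<and> x = x"
  by (metis join_meet_absorb meet_join_absorb meet_closed)

lemma le_refl [simp]: "x \<in> carrier L \<Longrightarrow> x \<preceq> x"
  by (simp add: rl_le_def meet_idem)

lemma le_antisym: "\<lbrakk>x \<preceq> y; y \<preceq> x; x \<in> carrier L; y \<in> carrier L\<rbrakk> \<Longrightarrow> x = y"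
  by (metis rl_le_def meet_comm)

lemma le_trans:
  "\<lbrakk>x \<preceq> y; y \<preceq> z; x \<in> carrier L; y \<in> carrier L; z \<in> carrier L\<rbrakk> \<Longrightarrow> x \<preceq> z"
  by (metis rl_le_def meet_assoc)

lemma meet_le1 [simp]: "\<lbrakk>x \<in> carrier L; y \<in> carrier L\<rbrakk> \<Longrightarrow> x \<^bold>\<and> y \<preceq> x"
  by (metis rl_le_def meet_assoc meet_comm meet_idem)

lemma meet_le2 [simp]: "\<lbrakk>x \<in> carrier L; y \<in> carrier L\<rbrakk> \<Longrightarrow> x \<^bold>\<and> y \<preceq> y"
  by (metis meet_le1 meet_comm)

lemma meet_greatest:
  "\<lbrakk>z \<preceq> x; z \<preceq> y; x \<in> carrier L; y \<in> carrier L; z \<in> carrier L\<rbrakk> \<Longrightarrow> z \<preceq> x \<^bold>\<and> y"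
  by (metis rl_le_def meet_assoc)

lemma le_iff_join: "\<lbrakk>x \<in> carrier L; y \<in> carrier L\<rbrakk> \<Longrightarrow> x \<preceq> y \<longleftrightarrow> x \<^bold>\<or> y = y"
  by (metis rl_le_def join_comm meet_comm join_meet_absorb meet_join_absorb)

lemma join_ge1 [simp]: "\<lbrakk>x \<in> carrier L; y \<in> carrier L\<rbrakk> \<Longrightarrow> x \<preceq> x \<^bold>\<or> y"
  by (simp add: rl_le_def meet_join_absorb)

lemma join_ge2 [simp]: "\<lbrakk>x \<in> carrier L; y \<in> carrier L\<rbrakk> \<Longrightarrow> y \<preceq> x \<^bold>\<or> y"
  by (metis join_ge1 join_comm)

lemma join_least:
  "\<lbrakk>x \<preceq> z; y \<preceq> z; x \<in> carrier L; y \<in> carrier L; z \<in> carrier L\<rbrakk> \<Longrightarrow> x \<^bold>\<or> y \<preceq> z"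
  by (simp add: le_iff_join join_assoc)

lemma mult_left_mono:
  "\<lbrakk>x \<preceq> y; x \<in> carrier L; y \<in> carrier L; z \<in> carrier L\<rbrakk> \<Longrightarrow> z \<otimes> x \<preceq> z \<otimes> y"
  by (meson ldiv_residual ldiv_closed le_refl le_trans m_closed)

lemma mult_right_mono:
  "\<lbrakk>x \<preceq> y; x \<in> carrier L; y \<in> carrier L; z \<in> carrier L\<rbrakk> \<Longrightarrow> x \<otimes> z \<preceq> y \<otimes> z"
  by (meson rdiv_residual rdiv_closed le_refl le_trans m_closed)

lemma mult_mono:
  "\<lbrakk>x \<preceq> y; z \<preceq> w; x \<in> carrier L; y \<in> carrier L; z \<in> carrier L; w \<in> carrier L\<rbrakk>
    \<Longrightarrow> x \<otimes> z \<preceq> y \<otimes> w"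
  by (meson le_trans m_closed mult_left_mono mult_right_mono)

lemma mult_le_left:
  "\<lbrakk>y \<preceq> \<one>; x \<in> carrier L; y \<in> carrier L\<rbrakk> \<Longrightarrow> x \<otimes> y \<preceq> x"
  using mult_left_mono[of y \<one> x] by simp

lemma mult_le_right:
  "\<lbrakk>y \<preceq> \<one>; x \<in> carrier L; y \<in> carrier L\<rbrakk> \<Longrightarrow> y \<otimes> x \<preceq> x"
  using mult_right_mono[of y \<one> x] by simp

lemma mult_negative:
  "\<lbrakk>x \<preceq> \<one>; y \<preceq> \<one>; x \<in> carrier L; y \<in> carrier L\<rbrakk> \<Longrightarrow> x \<otimes> y \<preceq> \<one>"
  by (meson le_trans m_closed mult_le_left one_closed)

lemma mult_ldiv_le: "\<lbrakk>x \<in> carrier L; y \<in> carrier L\<rbrakk> \<Longrightarrow> x \<otimes> (x \<setminus> y) \<preceq> y"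
  by (simp add: ldiv_residual)

lemma rdiv_mult_le: "\<lbrakk>x \<in> carrier L; y \<in> carrier L\<rbrakk> \<Longrightarrow> (y \<sslash> x) \<otimes> x \<preceq> y"
  by (simp add: rdiv_residual)

lemma join_mult_le:
  assumes "x \<otimes> z \<preceq> d" "y \<otimes> z \<preceq> d"
    and [simp]: "x \<in> carrier L" "y \<in> carrier L" "z \<in> carrier L" "d \<in> carrier L"
  shows "(x \<^bold>\<or> y) \<otimes> z \<preceq> d"
  using assms(1,2) by (simp add: rdiv_residual join_least)

lemma mult_join_le:
  assumes "z \<otimes> x \<preceq> d" "z \<otimes> y \<preceq> d"
    and [simp]: "x \<in> carrier L" "y \<in> carrier L" "z \<in> carrier L" "d \<in> carrier L"
  shows "z \<otimes> (x \<^bold>\<or> y) \<preceq> d"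
  using assms(1,2) by (simp add: ldiv_residual join_least)

lemma negative_join_mult_le:
  assumes "p \<preceq> \<one>" "q \<preceq> \<one>" "w \<preceq> \<one>"
    and [simp]: "p \<in> carrier L" "q \<in> carrier L" "w \<in> carrier L"
  shows "(p \<^bold>\<or> w) \<otimes> (q \<^bold>\<or> w) \<preceq> p \<otimes> q \<^bold>\<or> w"
proof -
  have w: "y \<preceq> p \<otimes> q \<^bold>\<or> w" if "y \<preceq> w" "y \<in> carrier L" for y
    using that le_trans[of y w "p \<otimes> q \<^bold>\<or> w"] by simp
  show ?thesis
    using assms(1-3) by (intro join_mult_le mult_join_le) (auto intro!: w mult_le_left mult_le_right)
qed

section \<open>Convex subuniverses of e-cyclic residuated lattices\<close>

lemma e_cyclic_commute:
  assumes "e_cyclic L" "x \<in> carrier L" "y \<in> carrier L"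
  shows "x \<otimes> y \<preceq> \<one> \<longleftrightarrow> y \<otimes> x \<preceq> \<one>"
  using assms by (metis e_cyclic_def ldiv_residual rdiv_residual one_closed)

text \<open>The upper bound on an element \<open>x\<close> of the hull is written \<open>x \<otimes> p \<preceq> \<one>\<close>, that is
  \<open>x \<preceq> \<one> \<sslash> p\<close>, with the same \<open>p\<close> as in the lower bound. When \<open>N\<close> is a submonoid of
  negative elements, a product of two such \<open>p\<close> serves wherever either of them does.\<close>

definition hull :: "'a set \<Rightarrow> 'a set"
  where "hull N = {x \<in> carrier L. \<exists>p\<in>N. p \<preceq> x \<and> x \<otimes> p \<preceq> \<one>}"

lemma hullI: "\<lbrakk>p \<in> N; x \<in> carrier L; p \<preceq> x; x \<otimes> p \<preceq> \<one>\<rbrakk> \<Longrightarrow> x \<in> hull N"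
  by (auto simp: hull_def)

text \<open>The condition \<open>x \<otimes> p \<preceq> \<one>\<close> bounds \<open>x\<close> by a right division. A left division \<open>x \<setminus> y\<close> with
  \<open>p \<preceq> x\<close> is only controlled from the other side, by \<open>p \<otimes> (x \<setminus> y) \<preceq> y\<close>; cyclicity is what
  makes the two sides agree.\<close>

lemma convex_subuniverse_hull:
  assumes cyc: "e_cyclic L"
    and N: "N \<subseteq> carrier L" and neg: "\<And>p. p \<in> N \<Longrightarrow> p \<preceq> \<one>"
    and one: "\<one> \<in> N" and mult: "\<And>p q. \<lbrakk>p \<in> N; q \<in> N\<rbrakk> \<Longrightarrow> p \<otimes> q \<in> N"
  shows "convex_subuniverse L (hull N)"
proof -
  have [simp]: "p \<in> carrier L" if "p \<in> N" for p using that N by blast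
  have common: "\<exists>p\<in>N. p \<preceq> x \<and> x \<otimes> p \<preceq> \<one> \<and> p \<preceq> y \<and> y \<otimes> p \<preceq> \<one>"
    if x: "x \<in> hull N" and y: "y \<in> hull N" for x y
  proof -
    from x y obtain p q where [simp]: "x \<in> carrier L" "y \<in> carrier L" "p \<in> N" "q \<in> N"
      and le: "p \<preceq> x" "x \<otimes> p \<preceq> \<one>" "q \<preceq> y" "y \<otimes> q \<preceq> \<one>"
      unfolding hull_def by blast
    have pq: "p \<otimes> q \<preceq> p" "p \<otimes> q \<preceq> q"
      by (simp_all add: neg mult_le_left mult_le_right)
    have down: "p \<otimes> q \<preceq> z \<and> z \<otimes> (p \<otimes> q) \<preceq> \<one>"
      if "r \<preceq> z" "z \<otimes> r \<preceq> \<one>" "p \<otimes> q \<preceq> r" "z \<in> carrier L" "r \<in> N" for z r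
      using that le_trans[of "p \<otimes> q" r z] le_trans[of "z \<otimes> (p \<otimes> q)" "z \<otimes> r" \<one>]
        mult_left_mono[of "p \<otimes> q" r z] by simp
    show ?thesis
      by (rule bexI[of _ "p \<otimes> q"]) (use down[OF le(1,2) pq(1)] down[OF le(3,4) pq(2)] mult in auto)
  qed
  have ops: "x \<otimes> y \<in> hull N \<and> x \<^bold>\<and> y \<in> hull N \<and> x \<^bold>\<or> y \<in> hull N \<and> x \<setminus> y \<in> hull N \<and> x \<sslash> y \<in> hull N"
    if x: "x \<in> hull N" and y: "y \<in> hull N" for x y
  proof -
    have [simp]: "x \<in> carrier L" "y \<in> carrier L" using x y by (auto simp: hull_def)
    obtain p where [simp]: "p \<in> N" and le: "p \<preceq> x" "x \<otimes> p \<preceq> \<one>" "p \<preceq> y" "y \<otimes> p \<preceq> \<one>"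
      using common[OF x y] by blast
    have le': "p \<otimes> x \<preceq> \<one>" "p \<otimes> y \<preceq> \<one>"
      using le(2,4) e_cyclic_commute[OF cyc, of p] by simp_all
    have pp: "p \<otimes> p \<in> N" by (simp add: mult)
    \<comment> \<open>The bound for a product or a quotient of two elements bounded by \<open>p\<close> is \<open>p \<otimes> p\<close>.\<close>
    have prod: "x \<otimes> y \<in> hull N"
    proof -
      have "x \<otimes> (y \<otimes> p) \<otimes> p \<preceq> x \<otimes> p"
        using mult_right_mono[of "x \<otimes> (y \<otimes> p)" x p] mult_le_left[of "y \<otimes> p" x] le by simp
      then have "x \<otimes> y \<otimes> (p \<otimes> p) \<preceq> \<one>"
        using le_trans[of "x \<otimes> y \<otimes> (p \<otimes> p)" "x \<otimes> p" \<one>] le by (simp add: m_assoc)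
      moreover have "p \<otimes> p \<preceq> x \<otimes> y" using le by (simp add: mult_mono)
      ultimately show ?thesis using pp by (intro hullI[of "p \<otimes> p"]) simp_all
    qed
    have meet: "x \<^bold>\<and> y \<in> hull N"
      using le le_trans[of "(x \<^bold>\<and> y) \<otimes> p" "x \<otimes> p" \<one>] mult_right_mono[of "x \<^bold>\<and> y" x p]
      by (intro hullI[of p]) (simp_all add: meet_greatest)
    have join: "x \<^bold>\<or> y \<in> hull N"
      using le le_trans[of p x "x \<^bold>\<or> y"]
      by (intro hullI[of p]) (simp_all add: join_mult_le)
    have ldiv: "x \<setminus> y \<in> hull N"
    proof -
      have "x \<otimes> p \<otimes> p \<preceq> p" using le by (simp add: mult_le_right)
      then have "x \<otimes> (p \<otimes> p) \<preceq> y"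
        using le le_trans[of "x \<otimes> p \<otimes> p" p y] by (simp add: m_assoc)
      then have low: "p \<otimes> p \<preceq> x \<setminus> y" by (simp add: ldiv_residual)
      have "p \<otimes> (x \<setminus> y) \<preceq> y"
        using le mult_right_mono[of p x "x \<setminus> y"] mult_ldiv_le[of x y]
          le_trans[of "p \<otimes> (x \<setminus> y)" "x \<otimes> (x \<setminus> y)" y] by simp
      then have "p \<otimes> (p \<otimes> (x \<setminus> y)) \<preceq> \<one>"
        using le' mult_left_mono[of "p \<otimes> (x \<setminus> y)" y p]
          le_trans[of "p \<otimes> (p \<otimes> (x \<setminus> y))" "p \<otimes> y" \<one>] by simp
      then have "(x \<setminus> y) \<otimes> (p \<otimes> p) \<preceq> \<one>"
        using e_cyclic_commute[OF cyc, of "x \<setminus> y" "p \<otimes> p"] by (simp add: m_assoc)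
      with low pp show ?thesis by (intro hullI[of "p \<otimes> p"]) simp_all
    qed
    have rdiv: "x \<sslash> y \<in> hull N"
    proof -
      have "p \<otimes> (p \<otimes> y) \<preceq> p" using le' by (simp add: mult_le_left)
      then have "p \<otimes> p \<otimes> y \<preceq> x"
        using le le_trans[of "p \<otimes> (p \<otimes> y)" p x] by (simp add: m_assoc)
      then have low: "p \<otimes> p \<preceq> x \<sslash> y" by (simp add: rdiv_residual)
      have "(x \<sslash> y) \<otimes> p \<preceq> x"
        using le mult_left_mono[of p y "x \<sslash> y"] rdiv_mult_le[of y x]
          le_trans[of "(x \<sslash> y) \<otimes> p" "(x \<sslash> y) \<otimes> y" x] by simp
      then have "(x \<sslash> y) \<otimes> p \<otimes> p \<preceq> \<one>"
        using le mult_right_mono[of "(x \<sslash> y) \<otimes> p" x p]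
          le_trans[of "(x \<sslash> y) \<otimes> p \<otimes> p" "x \<otimes> p" \<one>] by simp
      with low pp show ?thesis by (intro hullI[of "p \<otimes> p"]) (simp_all add: m_assoc)
    qed
    from prod meet join ldiv rdiv show ?thesis by blast
  qed
  have convex: "y \<in> hull N"
    if x: "x \<in> hull N" and z: "z \<in> hull N" and y: "y \<in> carrier L" "x \<preceq> y" "y \<preceq> z" for x y z
  proof -
    obtain p where "p \<in> N" "p \<preceq> x" "z \<otimes> p \<preceq> \<one>" using common[OF x z] by blast
    moreover have "x \<in> carrier L" "z \<in> carrier L" using x z by (auto simp: hull_def)
    ultimately show ?thesis
      using y le_trans[of p x y] le_trans[of "y \<otimes> p" "z \<otimes> p" \<one>] mult_right_mono[of y z p]
      by (intro hullI[of p]) simp_all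
  qed
  have "\<one> \<in> hull N" using one by (intro hullI[of \<one>]) simp_all
  moreover have "hull N \<subseteq> carrier L" by (auto simp: hull_def)
  ultimately show ?thesis
    unfolding convex_subuniverse_def subuniverse_def using ops convex by blast
qed

lemma convex_subuniverse_carrier: "\<lbrakk>convex_subuniverse L H; x \<in> H\<rbrakk> \<Longrightarrow> x \<in> carrier L"
  unfolding convex_subuniverse_def subuniverse_def by blast

lemma convex_subuniverse_one: "convex_subuniverse L H \<Longrightarrow> \<one> \<in> H"
  unfolding convex_subuniverse_def subuniverse_def by blast

lemma convex_subuniverse_ops:
  assumes "convex_subuniverse L H" "x \<in> H" "y \<in> H"
  shows "x \<otimes> y \<in> H" "x \<^bold>\<and> y \<in> H" "x \<^bold>\<or> y \<in> H" "x \<setminus> y \<in> H" "x \<sslash> y \<in> H"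
  using assms unfolding convex_subuniverse_def subuniverse_def by blast+

lemma convex_subuniverse_negative:
  "\<lbrakk>convex_subuniverse L H; h \<in> H; h \<preceq> x; x \<preceq> \<one>; x \<in> carrier L\<rbrakk> \<Longrightarrow> x \<in> H"
  using convex_subuniverse_one[of H] unfolding convex_subuniverse_def by blast

text \<open>For \<open>w \<preceq> \<one>\<close> this is the pseudocomplement, relative to \<open>H\<close>, of the convex subuniverse
  generated by \<open>w\<close>: the largest one whose intersection with it lies in \<open>H\<close>.\<close>

definition polar :: "'a set \<Rightarrow> 'a \<Rightarrow> 'a set"
  where "polar H w = hull {p \<in> carrier L. p \<preceq> \<one> \<and> p \<^bold>\<or> w \<in> H}"

lemma convex_subuniverse_polar:
  assumes cyc: "e_cyclic L" and H: "convex_subuniverse L H"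
    and w: "w \<in> carrier L" "w \<preceq> \<one>"
  shows "convex_subuniverse L (polar H w)"
  unfolding polar_def
proof (rule convex_subuniverse_hull[OF cyc])
  have "\<one> \<^bold>\<or> w = \<one>" using w by (metis join_comm le_iff_join one_closed)
  then show "\<one> \<in> {p \<in> carrier L. p \<preceq> \<one> \<and> p \<^bold>\<or> w \<in> H}"
    using convex_subuniverse_one[OF H] by simp
next
  fix p q
  assume "p \<in> {p \<in> carrier L. p \<preceq> \<one> \<and> p \<^bold>\<or> w \<in> H}" "q \<in> {p \<in> carrier L. p \<preceq> \<one> \<and> p \<^bold>\<or> w \<in> H}"
  then have pq: "p \<in> carrier L" "q \<in> carrier L" "p \<preceq> \<one>" "q \<preceq> \<one>" "p \<^bold>\<or> w \<in> H" "q \<^bold>\<or> w \<in> H"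
    by auto
  have "p \<otimes> q \<preceq> \<one>" using pq by (simp add: mult_negative)
  moreover have "p \<otimes> q \<^bold>\<or> w \<in> H"
    using pq w negative_join_mult_le[of p q w] convex_subuniverse_ops(1)[OF H pq(5,6)]
    by - (rule convex_subuniverse_negative[OF H, of "(p \<^bold>\<or> w) \<otimes> (q \<^bold>\<or> w)"],
        auto intro: join_least mult_negative)
  ultimately show "p \<otimes> q \<in> {p \<in> carrier L. p \<preceq> \<one> \<and> p \<^bold>\<or> w \<in> H}" using pq by simp
qed auto

lemma subset_polar:
  assumes H: "convex_subuniverse L H" and w: "w \<in> carrier L" "w \<preceq> \<one>"
  shows "H \<subseteq> polar H w"
proof
  fix x assume x: "x \<in> H"
  note [simp] = convex_subuniverse_carrier[OF H x]
  \<comment> \<open>The negative absolute value of \<open>x\<close> bounds \<open>x\<close> from both sides.\<close>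
  define p where "p = x \<^bold>\<and> (x \<setminus> \<one>) \<^bold>\<and> \<one>"
  have pH: "p \<in> H" unfolding p_def
    using x convex_subuniverse_one[OF H] by (intro convex_subuniverse_ops[OF H])
  have [simp]: "p \<in> carrier L" and neg: "p \<preceq> \<one>" by (simp_all add: p_def)
  have px: "p \<preceq> x \<^bold>\<and> (x \<setminus> \<one>)" by (simp add: p_def)
  have "p \<preceq> x" using px le_trans[of p "x \<^bold>\<and> (x \<setminus> \<one>)" x] by simp
  moreover have "x \<otimes> p \<preceq> \<one>"
    using px le_trans[of p "x \<^bold>\<and> (x \<setminus> \<one>)" "x \<setminus> \<one>"] by (simp add: ldiv_residual)
  moreover have "p \<^bold>\<or> w \<in> H"
    using pH w neg by - (rule convex_subuniverse_negative[OF H pH], auto intro: join_least)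
  ultimately show "x \<in> polar H w" using neg unfolding polar_def by (intro hullI[of p]) simp_all
qed

lemma negative_mem_polar_iff:
  assumes H: "convex_subuniverse L H"
    and w: "w \<in> carrier L" "w \<preceq> \<one>" and x: "x \<in> carrier L" "x \<preceq> \<one>"
  shows "x \<in> polar H w \<longleftrightarrow> x \<^bold>\<or> w \<in> H"
proof
  assume "x \<in> polar H w"
  then obtain p where p: "p \<in> carrier L" "p \<preceq> x" "p \<^bold>\<or> w \<in> H"
    by (auto simp: polar_def hull_def)
  have "p \<^bold>\<or> w \<preceq> x \<^bold>\<or> w"
    using p w x le_trans[of p x "x \<^bold>\<or> w"] by (simp add: join_least)
  then show "x \<^bold>\<or> w \<in> H"
    using w x by - (rule convex_subuniverse_negative[OF H p(3)], auto intro: join_least)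
next
  assume "x \<^bold>\<or> w \<in> H"
  then show "x \<in> polar H w"
    using x unfolding polar_def by (intro hullI[of x]) (simp_all add: mult_negative)
qed

lemma convex_subuniverse_Union_chain:
  assumes conv: "\<And>H. H \<in> C \<Longrightarrow> convex_subuniverse L H"
    and chain: "\<And>H K. \<lbrakk>H \<in> C; K \<in> C\<rbrakk> \<Longrightarrow> H \<subseteq> K \<or> K \<subseteq> H" and ne: "C \<noteq> {}"
  shows "convex_subuniverse L (\<Union>C)"
proof -
  have common: "\<exists>K\<in>C. x \<in> K \<and> y \<in> K" if "x \<in> \<Union>C" "y \<in> \<Union>C" for x y
    using that chain by blast
  have ops: "x \<otimes> y \<in> \<Union>C \<and> x \<^bold>\<and> y \<in> \<Union>C \<and> x \<^bold>\<or> y \<in> \<Union>C \<and> x \<setminus> y \<in> \<Union>C \<and> x \<sslash> y \<in> \<Union>C"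
    if xy: "x \<in> \<Union>C" "y \<in> \<Union>C" for x y
  proof -
    obtain K where K: "K \<in> C" "x \<in> K" "y \<in> K" using common[OF xy] by blast
    then show ?thesis using convex_subuniverse_ops[OF conv[OF K(1)] K(2,3)] by blast
  qed
  have convex: "y \<in> \<Union>C"
    if "x \<in> \<Union>C" "z \<in> \<Union>C" "y \<in> carrier L" "x \<preceq> y" "y \<preceq> z" for x y z
  proof -
    obtain K where K: "K \<in> C" "x \<in> K" "z \<in> K" using common[OF \<open>x \<in> \<Union>C\<close> \<open>z \<in> \<Union>C\<close>] by blast
    then have "y \<in> K" using conv[OF K(1)] that(3-5) unfolding convex_subuniverse_def by blast
    then show ?thesis using K(1) by blast
  qed
  have "\<one> \<in> \<Union>C" using ne conv convex_subuniverse_one by blast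
  moreover have "\<Union>C \<subseteq> carrier L" using conv convex_subuniverse_carrier by blast
  ultimately show ?thesis
    unfolding convex_subuniverse_def subuniverse_def using ops convex by (intro conjI ballI impI) blast+
qed

lemma maximal_convex_subuniverse_avoiding:
  assumes cyc: "e_cyclic L" and c: "c \<in> carrier L" "c \<noteq> \<one>"
  obtains H where "convex_subuniverse L H" "c \<notin> H"
    and "\<And>K. \<lbrakk>convex_subuniverse L K; H \<subseteq> K; c \<notin> K\<rbrakk> \<Longrightarrow> K = H"
proof -
  let ?S = "{H. convex_subuniverse L H \<and> c \<notin> H}"
  \<comment> \<open>The trivial subuniverse is the hull of the trivial submonoid.\<close>
  have "convex_subuniverse L (hull {\<one>})" by (rule convex_subuniverse_hull[OF cyc]) auto
  moreover have "c \<notin> hull {\<one>}" using c by (auto simp: hull_def dest: le_antisym)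
  ultimately have "?S \<noteq> {}" by blast
  moreover have "\<Union>C \<in> ?S" if "C \<noteq> {}" "subset.chain ?S C" for C
    using that convex_subuniverse_Union_chain[of C] by (auto simp: subset_chain_def)
  ultimately obtain M where "M \<in> ?S" "\<forall>X\<in>?S. M \<subseteq> X \<longrightarrow> X = M"
    using subset_Zorn_nonempty[of ?S] by blast
  then show ?thesis by (intro that[of M]) auto
qed

text \<open>Passing to the polar of \<open>v\<close> and then to that of \<open>c\<close> replaces first \<open>u\<close> and then \<open>v\<close> by \<open>c\<close>
  in \<open>u \<^bold>\<or> v \<in> H\<close>.\<close>

lemma maximal_convex_subuniverse_prime:
  assumes cyc: "e_cyclic L" and c: "c \<in> carrier L" "c \<preceq> \<one>"
    and H: "convex_subuniverse L H" and cH: "c \<notin> H"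
    and max: "\<And>K. \<lbrakk>convex_subuniverse L K; H \<subseteq> K; c \<notin> K\<rbrakk> \<Longrightarrow> K = H"
    and u: "u \<in> carrier L" "u \<preceq> \<one>" and v: "v \<in> carrier L" "v \<preceq> \<one>" and uv: "u \<^bold>\<or> v \<in> H"
  shows "u \<in> H \<or> v \<in> H"
proof -
  have step: "c \<^bold>\<or> y \<in> H"
    if "x \<^bold>\<or> y \<in> H" "x \<notin> H" and x: "x \<in> carrier L" "x \<preceq> \<one>" and y: "y \<in> carrier L" "y \<preceq> \<one>" for x y
  proof -
    have "x \<in> polar H y" using that negative_mem_polar_iff[OF H] by blast
    then have "polar H y \<noteq> H" using \<open>x \<notin> H\<close> by blast
    then have "c \<in> polar H y"
      using max[OF convex_subuniverse_polar[OF cyc H y] subset_polar[OF H y]] by blast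
    then show ?thesis using negative_mem_polar_iff[OF H y c] by simp
  qed
  show ?thesis
  proof (rule ccontr)
    assume neither: "\<not> (u \<in> H \<or> v \<in> H)"
    then have "c \<^bold>\<or> v \<in> H" using step[OF uv _ u v] by blast
    then have "v \<^bold>\<or> c \<in> H" using c v by (simp add: join_comm)
    then have "c \<^bold>\<or> c \<in> H" using neither step[OF _ _ v c] by blast
    then show False using cH c le_iff_join[of c c] by simp
  qed
qed

end

section \<open>The quotient by a normal convex subuniverse\<close>

locale normal_quotient = residuated_lattice +
  fixes H
  assumes normal: "normal_convex_subuniverse L H"
begin

lemma H_convex: "convex_subuniverse L H"
  using normal by (simp add: normal_convex_subuniverse_def)

lemma H_carrier [simp]: "h \<in> H \<Longrightarrow> h \<in> carrier L"
  by (rule convex_subuniverse_carrier[OF H_convex])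

definition le_mod :: "'a \<Rightarrow> 'a \<Rightarrow> bool" (infix \<open>\<lesssim>\<close> 50)
  where "a \<lesssim> b \<longleftrightarrow> (\<exists>h\<in>H. h \<preceq> \<one> \<and> a \<otimes> h \<preceq> b)"

lemma le_mod_ldiv_iff:
  assumes [simp]: "a \<in> carrier L" "b \<in> carrier L"
  shows "a \<lesssim> b \<longleftrightarrow> a \<setminus> b \<^bold>\<and> \<one> \<in> H"
proof
  assume "a \<lesssim> b"
  then obtain h where "h \<in> H" "h \<preceq> \<one>" "a \<otimes> h \<preceq> b" by (auto simp: le_mod_def)
  then show "a \<setminus> b \<^bold>\<and> \<one> \<in> H"
    by - (rule convex_subuniverse_negative[OF H_convex, of h],
        auto simp: ldiv_residual intro: meet_greatest)
next
  assume "a \<setminus> b \<^bold>\<and> \<one> \<in> H"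
  then show "a \<lesssim> b"
    by (auto simp: le_mod_def ldiv_residual intro!: bexI[of _ "a \<setminus> b \<^bold>\<and> \<one>"])
qed

text \<open>A conjugate of \<open>h\<close> by \<open>a\<close> lets \<open>h\<close> pass from one side of \<open>a\<close> to the other; this is the only
  use of normality.\<close>

lemma le_mod_left:
  assumes [simp]: "a \<in> carrier L" "b \<in> carrier L"
  shows "a \<lesssim> b \<longleftrightarrow> (\<exists>h\<in>H. h \<preceq> \<one> \<and> h \<otimes> a \<preceq> b)"
proof
  assume "a \<lesssim> b"
  then obtain h where h: "h \<in> H" "a \<otimes> h \<preceq> b" by (auto simp: le_mod_def)
  define k where "k = right_conj L a h"
  have "k \<in> H" using normal h by (simp add: k_def normal_convex_subuniverse_def)
  moreover have "k \<preceq> \<one>" using h by (simp add: k_def right_conj_def)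
  moreover have "k \<otimes> a \<preceq> a \<otimes> h" using h by (simp add: k_def right_conj_def rdiv_residual)
  ultimately show "\<exists>h\<in>H. h \<preceq> \<one> \<and> h \<otimes> a \<preceq> b"
    using h le_trans[of "k \<otimes> a" "a \<otimes> h" b] by auto
next
  assume "\<exists>h\<in>H. h \<preceq> \<one> \<and> h \<otimes> a \<preceq> b"
  then obtain h where h: "h \<in> H" "h \<otimes> a \<preceq> b" by blast
  define k where "k = left_conj L a h"
  have "k \<in> H" using normal h by (simp add: k_def normal_convex_subuniverse_def)
  moreover have "k \<preceq> \<one>" using h by (simp add: k_def left_conj_def)
  moreover have "a \<otimes> k \<preceq> h \<otimes> a" using h by (simp add: k_def left_conj_def ldiv_residual)
  ultimately show "a \<lesssim> b"
    using h le_trans[of "a \<otimes> k" "h \<otimes> a" b] by (auto simp: le_mod_def)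
qed

lemma le_imp_le_mod: "\<lbrakk>a \<preceq> b; a \<in> carrier L; b \<in> carrier L\<rbrakk> \<Longrightarrow> a \<lesssim> b"
  using convex_subuniverse_one[OF H_convex] by (auto simp: le_mod_def intro!: bexI[of _ \<one>])

lemma le_mod_trans:
  assumes "a \<lesssim> b" "b \<lesssim> d" and [simp]: "a \<in> carrier L" "b \<in> carrier L" "d \<in> carrier L"
  shows "a \<lesssim> d"
proof -
  obtain h k where [simp]: "h \<in> H" "k \<in> H" and hk: "h \<preceq> \<one>" "k \<preceq> \<one>" "a \<otimes> h \<preceq> b" "b \<otimes> k \<preceq> d"
    using assms(1,2) by (auto simp: le_mod_def)
  have "a \<otimes> (h \<otimes> k) \<preceq> d"
    using hk mult_right_mono[of "a \<otimes> h" b k] le_trans[of "a \<otimes> h \<otimes> k" "b \<otimes> k" d]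
    by (simp add: m_assoc)
  then show ?thesis
    using hk convex_subuniverse_ops(1)[OF H_convex]
    by (auto simp: le_mod_def intro!: bexI[of _ "h \<otimes> k"] mult_negative)
qed

lemma le_mod_mult_residual:
  assumes [simp]: "a \<in> carrier L" "b \<in> carrier L" "d \<in> carrier L"
  shows "a \<otimes> b \<lesssim> d \<longleftrightarrow> b \<lesssim> a \<setminus> d" "a \<otimes> b \<lesssim> d \<longleftrightarrow> a \<lesssim> d \<sslash> b"
proof -
  show "a \<otimes> b \<lesssim> d \<longleftrightarrow> b \<lesssim> a \<setminus> d"
    by (auto simp: le_mod_def m_assoc ldiv_residual)
  show "a \<otimes> b \<lesssim> d \<longleftrightarrow> a \<lesssim> d \<sslash> b"
    by (auto simp: le_mod_left rdiv_residual simp flip: m_assoc)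
qed

lemma le_mod_common:
  assumes "a \<lesssim> b" "x \<lesssim> y"
    and [simp]: "a \<in> carrier L" "b \<in> carrier L" "x \<in> carrier L" "y \<in> carrier L"
  obtains h where "h \<in> H" "h \<preceq> \<one>" "a \<otimes> h \<preceq> b" "x \<otimes> h \<preceq> y"
proof -
  obtain h k where [simp]: "h \<in> H" "k \<in> H" and hk: "h \<preceq> \<one>" "k \<preceq> \<one>" "a \<otimes> h \<preceq> b" "x \<otimes> k \<preceq> y"
    using assms(1,2) by (auto simp: le_mod_def)
  have "a \<otimes> (h \<otimes> k) \<preceq> a \<otimes> h" "x \<otimes> (h \<otimes> k) \<preceq> x \<otimes> k"
    using hk by (auto intro!: mult_left_mono mult_le_left mult_le_right)
  then have "a \<otimes> (h \<otimes> k) \<preceq> b" "x \<otimes> (h \<otimes> k) \<preceq> y"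
    using hk le_trans[of "a \<otimes> (h \<otimes> k)" "a \<otimes> h" b] le_trans[of "x \<otimes> (h \<otimes> k)" "x \<otimes> k" y] by auto
  then show ?thesis
    using hk convex_subuniverse_ops(1)[OF H_convex] by (intro that[of "h \<otimes> k"]) (auto intro: mult_negative)
qed

lemma le_mod_meet:
  assumes "d \<lesssim> a" "d \<lesssim> b" and [simp]: "a \<in> carrier L" "b \<in> carrier L" "d \<in> carrier L"
  shows "d \<lesssim> a \<^bold>\<and> b"
proof -
  obtain h where "h \<in> H" "h \<preceq> \<one>" "d \<otimes> h \<preceq> a" "d \<otimes> h \<preceq> b"
    using le_mod_common[OF assms(1,2)] by auto
  then show ?thesis by (auto simp: le_mod_def intro!: bexI[of _ h] meet_greatest)
qed

lemma le_mod_join: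
  assumes "a \<lesssim> d" "b \<lesssim> d" and [simp]: "a \<in> carrier L" "b \<in> carrier L" "d \<in> carrier L"
  shows "a \<^bold>\<or> b \<lesssim> d"
proof -
  obtain h where "h \<in> H" "h \<preceq> \<one>" "a \<otimes> h \<preceq> d" "b \<otimes> h \<preceq> d"
    using le_mod_common[OF assms(1,2)] by auto
  then show ?thesis by (auto simp: le_mod_def intro!: bexI[of _ h] join_mult_le)
qed

text \<open>Each operation is monotone or antitone in each argument because a universal property with
  respect to the preorder characterizes it.\<close>

lemma le_mod_mono:
  assumes le: "a \<lesssim> a'" "b \<lesssim> b'"
    and [simp]: "a \<in> carrier L" "a' \<in> carrier L" "b \<in> carrier L" "b' \<in> carrier L"
  shows "a \<otimes> b \<lesssim> a' \<otimes> b'" "a \<^bold>\<and> b \<lesssim> a' \<^bold>\<and> b'" "a \<^bold>\<or> b \<lesssim> a' \<^bold>\<or> b'"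
    "a' \<setminus> b \<lesssim> a \<setminus> b'" "a \<sslash> b' \<lesssim> a' \<sslash> b"
proof -
  have prod: "x \<otimes> y \<lesssim> x' \<otimes> y'"
    if "x \<lesssim> x'" "y \<lesssim> y'" and [simp]: "x \<in> carrier L" "x' \<in> carrier L" "y \<in> carrier L" "y' \<in> carrier L"
    for x x' y y'
  proof -
    have "x' \<lesssim> (x' \<otimes> y) \<sslash> y" "y' \<lesssim> x' \<setminus> (x' \<otimes> y')"
      by (auto simp: le_imp_le_mod simp flip: le_mod_mult_residual)
    then have "x \<lesssim> (x' \<otimes> y) \<sslash> y" "y \<lesssim> x' \<setminus> (x' \<otimes> y')"
      using that(1,2) le_mod_trans[of x x' "(x' \<otimes> y) \<sslash> y"] le_mod_trans[of y y' "x' \<setminus> (x' \<otimes> y')"]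
      by simp_all
    then have "x \<otimes> y \<lesssim> x' \<otimes> y" "x' \<otimes> y \<lesssim> x' \<otimes> y'"
      by (simp add: le_mod_mult_residual(2), simp add: le_mod_mult_residual(1))
    then show ?thesis by (rule le_mod_trans) simp_all
  qed
  show "a \<otimes> b \<lesssim> a' \<otimes> b'" using le by (simp add: prod)
  show "a \<^bold>\<and> b \<lesssim> a' \<^bold>\<and> b'"
    using le le_mod_trans[of "a \<^bold>\<and> b" a a'] le_mod_trans[of "a \<^bold>\<and> b" b b']
    by (intro le_mod_meet) (auto simp: le_imp_le_mod)
  show "a \<^bold>\<or> b \<lesssim> a' \<^bold>\<or> b'"
    using le le_mod_trans[of a a' "a' \<^bold>\<or> b'"] le_mod_trans[of b b' "a' \<^bold>\<or> b'"]
    by (intro le_mod_join) (auto simp: le_imp_le_mod)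
  have "a \<otimes> (a' \<setminus> b) \<lesssim> a' \<otimes> (a' \<setminus> b)" using le by (simp add: prod le_imp_le_mod)
  moreover have "a' \<otimes> (a' \<setminus> b) \<lesssim> b" by (simp add: le_imp_le_mod mult_ldiv_le)
  ultimately have "a \<otimes> (a' \<setminus> b) \<lesssim> b'" using le(2) by (meson le_mod_trans assms(3-) ldiv_closed m_closed)
  then show "a' \<setminus> b \<lesssim> a \<setminus> b'" by (simp add: le_mod_mult_residual(1))
  have "(a \<sslash> b') \<otimes> b \<lesssim> (a \<sslash> b') \<otimes> b'" using le by (simp add: prod le_imp_le_mod)
  moreover have "(a \<sslash> b') \<otimes> b' \<lesssim> a" by (simp add: le_imp_le_mod rdiv_mult_le)
  ultimately have "(a \<sslash> b') \<otimes> b \<lesssim> a'" using le(1) by (meson le_mod_trans assms(3-) rdiv_closed m_closed)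
  then show "a \<sslash> b' \<lesssim> a' \<sslash> b" by (simp add: le_mod_mult_residual(2))
qed

definition kernel :: "('a \<times> 'a) set"
  where "kernel = {(a, b). a \<in> carrier L \<and> b \<in> carrier L \<and> a \<lesssim> b \<and> b \<lesssim> a}"

lemma equiv_kernel: "equiv (carrier L) kernel"
proof (rule equivI)
  show "kernel \<subseteq> carrier L \<times> carrier L" by (auto simp: kernel_def)
  show "refl_on (carrier L) kernel" by (auto simp: refl_on_def kernel_def le_imp_le_mod)
  show "sym kernel" by (auto simp: sym_def kernel_def)
  show "trans kernel" unfolding trans_def kernel_def using le_mod_trans by blast
qed

definition cls :: "'a \<Rightarrow> 'a set"
  where "cls x = kernel `` {x}"

text \<open>The union runs over all representatives and is a single class as soon as \<open>f\<close> respects the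
  kernel.\<close>

definition lift :: "('a \<Rightarrow> 'a \<Rightarrow> 'a) \<Rightarrow> 'a set \<Rightarrow> 'a set \<Rightarrow> 'a set"
  where "lift f X Y = (\<Union>x\<in>X. \<Union>y\<in>Y. cls (f x y))"

definition quotient :: "'a set resid_lattice"
  where "quotient =
    \<lparr>carrier = cls ` carrier L, mult = lift (\<otimes>), one = cls \<one>, rl_meet = lift (\<^bold>\<and>),
     rl_join = lift (\<^bold>\<or>), ldiv = lift (\<setminus>), rdiv = lift (\<sslash>)\<rparr>"

lemma cls_eq_iff:
  "\<lbrakk>x \<in> carrier L; y \<in> carrier L\<rbrakk> \<Longrightarrow> cls x = cls y \<longleftrightarrow> x \<lesssim> y \<and> y \<lesssim> x"
  unfolding cls_def by (subst eq_equiv_class_iff[OF equiv_kernel]) (auto simp: kernel_def)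

lemma lift_cls:
  assumes "\<And>a a' b b'. \<lbrakk>(a, a') \<in> kernel; (b, b') \<in> kernel\<rbrakk> \<Longrightarrow> (f a b, f a' b') \<in> kernel"
    and "x \<in> carrier L" "y \<in> carrier L"
  shows "lift f (cls x) (cls y) = cls (f x y)"
proof -
  have "congruent2 kernel kernel (\<lambda>a b. cls (f a b))"
    using assms(1) by (auto simp: congruent2_def cls_def intro!: equiv_class_eq[OF equiv_kernel])
  from UN_equiv_class2[OF equiv_kernel equiv_kernel this assms(2,3)]
  show ?thesis by (simp add: lift_def flip: cls_def)
qed

lemma quotient_ops:
  assumes "x \<in> carrier L" "y \<in> carrier L"
  shows "cls x \<otimes>\<^bsub>quotient\<^esub> cls y = cls (x \<otimes> y)"
    "cls x \<^bold>\<and>\<^bsub>quotient\<^esub> cls y = cls (x \<^bold>\<and> y)"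
    "cls x \<^bold>\<or>\<^bsub>quotient\<^esub> cls y = cls (x \<^bold>\<or> y)"
    "cls x \<setminus>\<^bsub>quotient\<^esub> cls y = cls (x \<setminus> y)"
    "cls x \<sslash>\<^bsub>quotient\<^esub> cls y = cls (x \<sslash> y)"
  by (simp_all add: quotient_def, intro lift_cls assms; auto simp: kernel_def le_mod_mono)+

lemma quotient_hom: "cls \<in> rl_hom L quotient"
  by (auto simp: rl_hom_def quotient_ops) (auto simp: quotient_def)

lemma quotient_le_iff:
  assumes [simp]: "x \<in> carrier L" "y \<in> carrier L"
  shows "cls x \<preceq>\<^bsub>quotient\<^esub> cls y \<longleftrightarrow> x \<lesssim> y"
proof -
  have "x \<^bold>\<and> y \<lesssim> x" by (simp add: le_imp_le_mod)
  moreover have "x \<lesssim> x \<^bold>\<and> y \<longleftrightarrow> x \<lesssim> y"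
    using le_mod_trans[of x "x \<^bold>\<and> y" y] le_mod_meet[of x x y] by (auto simp: le_imp_le_mod)
  ultimately show ?thesis
    unfolding rl_le_def[where L = quotient] by (simp add: quotient_ops cls_eq_iff)
qed

lemma residuated_chain_quotient:
  assumes total: "\<And>x y. \<lbrakk>x \<in> carrier L; y \<in> carrier L\<rbrakk> \<Longrightarrow> x \<lesssim> y \<or> y \<lesssim> x"
  shows "residuated_chain quotient"
proof -
  have C: "carrier quotient = cls ` carrier L" and one: "\<one>\<^bsub>quotient\<^esub> = cls \<one>"
    by (simp_all add: quotient_def)
  show ?thesis
  proof
    fix X Y assume XY: "X \<in> carrier quotient" "Y \<in> carrier quotient"
    then show "X \<preceq>\<^bsub>quotient\<^esub> Y \<or> Y \<preceq>\<^bsub>quotient\<^esub> X"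
      using total quotient_le_iff unfolding C by (elim imageE) blast
    show "X \<^bold>\<and>\<^bsub>quotient\<^esub> Y = Y \<^bold>\<and>\<^bsub>quotient\<^esub> X" "X \<^bold>\<or>\<^bsub>quotient\<^esub> Y = Y \<^bold>\<or>\<^bsub>quotient\<^esub> X"
      using XY unfolding C by (elim imageE; simp add: quotient_ops meet_comm join_comm)+
  qed (auto simp: C one quotient_ops quotient_le_iff m_assoc meet_assoc join_assoc meet_join_absorb
      join_meet_absorb le_mod_mult_residual(2)[symmetric] le_mod_mult_residual(1)[symmetric])
qed

end

section \<open>Semilinearity\<close>

text \<open>Prelinearity supplies \<open>(x \<setminus> y \<^bold>\<and> \<one>) \<^bold>\<or> (y \<setminus> x \<^bold>\<and> \<one>) = \<one>\<close>, to which primeness of \<open>H\<close>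
  applies.\<close>

lemma (in residuated_lattice) separating_chain_quotient:
  assumes ham: "hamiltonian L" and pre: "prelinear L" and cyc: "e_cyclic L"
    and xy: "x \<in> carrier L" "y \<in> carrier L" "\<not> x \<preceq> y"
  obtains H where "normal_quotient L H" "residuated_chain (normal_quotient.quotient L H)"
    and "\<not> normal_quotient.le_mod L H x y"
proof -
  define c where "c = x \<setminus> y \<^bold>\<and> \<one>"
  have c: "c \<in> carrier L" "c \<preceq> \<one>" using xy by (simp_all add: c_def)
  have "\<one> \<preceq> x \<setminus> y" if "c = \<one>"
    using that meet_le1[of "x \<setminus> y" \<one>] xy by (simp add: c_def)
  then have "c \<noteq> \<one>" using xy by (auto simp flip: ldiv_residual)
  then obtain H where H: "convex_subuniverse L H" "c \<notin> H"
    and max: "\<And>K. \<lbrakk>convex_subuniverse L K; H \<subseteq> K; c \<notin> K\<rbrakk> \<Longrightarrow> K = H"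
    using maximal_convex_subuniverse_avoiding[OF cyc c(1)] by blast
  interpret Q: normal_quotient L H
    using ham H by unfold_locales (simp add: hamiltonian_def)
  have "residuated_chain Q.quotient"
  proof (rule Q.residuated_chain_quotient)
    fix a b assume ab: "a \<in> carrier L" "b \<in> carrier L"
    have "(a \<setminus> b \<^bold>\<and> \<one>) \<^bold>\<or> (b \<setminus> a \<^bold>\<and> \<one>) \<in> H"
      using pre ab convex_subuniverse_one[OF H(1)] by (simp add: prelinear_def)
    then have "a \<setminus> b \<^bold>\<and> \<one> \<in> H \<or> b \<setminus> a \<^bold>\<and> \<one> \<in> H"
      using ab by - (rule maximal_convex_subuniverse_prime[OF cyc c H max], auto)
    then show "Q.le_mod a b \<or> Q.le_mod b a"
      using ab by (simp add: Q.le_mod_ldiv_iff)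
  qed
  moreover have "\<not> Q.le_mod x y" using H(2) xy by (simp add: Q.le_mod_ldiv_iff c_def)
  ultimately show ?thesis using that Q.normal_quotient_axioms by blast
qed

theorem theorem5p2:
  fixes L :: "('a, 'm) resid_lattice_scheme"
  assumes "residuated_lattice L"
    and "hamiltonian L"
    and "prelinear L"
    and "e_cyclic L"
  shows "semilinear L"
proof -
  interpret residuated_lattice L by (rule assms(1))
  define I where "I = {H. normal_quotient L H \<and> residuated_chain (normal_quotient.quotient L H)}"
  have "subdirect_rep_by_chains L I (normal_quotient.quotient L)"
  proof (rule subdirect_rep_by_chainsI[OF assms(1), where g = "normal_quotient.cls L"])
    show "\<forall>H\<in>I. residuated_chain (normal_quotient.quotient L H)" by (simp add: I_def)
  next
    fix H assume "H \<in> I"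
    then interpret Q: normal_quotient L H by (simp add: I_def)
    show "Q.cls \<in> rl_hom L Q.quotient" by (rule Q.quotient_hom)
    show "Q.cls ` carrier L = carrier Q.quotient" by (simp add: Q.quotient_def)
  next
    fix x y assume xy: "x \<in> carrier L" "y \<in> carrier L"
      and eq: "\<forall>H\<in>I. normal_quotient.cls L H x = normal_quotient.cls L H y"
    have le: "a \<preceq>\<^bsub>L\<^esub> b"
      if ab: "a \<in> carrier L" "b \<in> carrier L"
        and eq: "\<forall>H\<in>I. normal_quotient.cls L H a = normal_quotient.cls L H b" for a b
    proof (rule ccontr)
      assume "\<not> a \<preceq>\<^bsub>L\<^esub> b"
      then obtain H where H: "normal_quotient L H" "residuated_chain (normal_quotient.quotient L H)"
        and not_le: "\<not> normal_quotient.le_mod L H a b"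
        using separating_chain_quotient[OF assms(2-4) ab] by blast
      interpret Q: normal_quotient L H by (rule H(1))
      have "Q.cls a = Q.cls b" using eq H by (simp add: I_def)
      then show False using not_le ab by (simp add: Q.cls_eq_iff)
    qed
    show "x = y" using le[OF xy eq] le[OF xy(2,1)] eq xy by (intro le_antisym) auto
  qed
  then show ?thesis by (rule semilinearI[OF assms(1)])
qed

end
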